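(* Suppose that $q_0$ is locally smooth at $\boldsymbol U_0^*$ with parameters $\varepsilon,L>0$ independent of $V$, i.e. for all $\boldsymbol U\succeq\boldsymbol 0$ with $\|\boldsymbol U-\boldsymbol U_0^*\|<\varepsilon$, $$q_0(\boldsymbol U_0^* )\ge q_0(\boldsymbol U)+L\|\boldsymbol U-\boldsymbol U_0^*\|^2 .$$ Then under QLA with a sufficiently large $V$: (a) There exists $D=\Theta(\sqrt V)$ such that whenever $\|\boldsymbol U(t)-\boldsymbol U_V^*\|\ge D$, $$\mathbb E\{\|\boldsymbol U(t+1)-\boldsymbol U_V^*\|\mid\boldsymbol U(t)\}\le\|\boldsymbol U(t)-\boldsymbol U_V^*\|-\frac1{\sqrt V}.$$ (b) With this $D$, for all $m\ge0$, $\mathcal P(D,m)\le c^*e^{-\beta^*m}$, where $c^*=\Theta(V)$, $\beta^*=\Theta(1/\sqrt V)$ and $$\mathcal P(D,m)\triangleq\limsup_{t\to\infty}\frac1t\sum_{\tau=0}^{t-1}\Pr\{\|\boldsymbol U(\tau)-\boldsymbol U_V^*\|>D+m\}.$$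
   Context: Network model. Time is slotted, $t=0,1,2,\dots$; there are $r\ge1$ queues. The network state $S(t)$ takes values in a finite set $\mathcal S=\{s_1,\dots,s_M\}$ and is i.i.d. over slots with $p_{s_i}=\Pr\{S(t)=s_i\}$. When $S(t)=s_i$, the controller observes $s_i$ and chooses an action $x$ in a compact feasible set $\mathcal X^{(s_i)}$; this incurs cost $f(t)=f(s_i,x)$ (the function $f$ is either everywhere nonnegative or everywhere nonpositive), arrivals $A_j(t)=g_j(s_i,x)\ge0$ to queue $j$ and service $\mu_j(t)=b_j(s_i,x)\ge0$ of queue $j$, $j=1,\dots,r$. The magnitudes of $f,g_j,b_j$ are bounded by a constant $\delta_{max}\in(0,\infty)$. Slackness: there are actions $x^{(s_i)k}\in\mathcal X^{(s_i)}$, $k=1,\dots,r+2$, and weights $\vartheta_k^{(s_i)}\ge0$ with $\sum_k\vartheta_k^{(s_i)}=1$ for each $s_i$, and some $\epsilon_s>0$, such that $\sum_{s_i}p_{s_i}\sum_k\vartheta_k^{(s_i)}[g_j(s_i,x^{(s_i)k})-b_j(s_i,x^{(s_i)k})]\le-\epsilon_s$ for all $j$. The backlog vector $\boldsymbol U(t)=(U_1(t),\dots,U_r(t))^T$ satisfies $\boldsymbol U(0)=\boldsymbol 0$ and $U_j(t+1)=\max[U_j(t)-\mu_j(t),0]+A_j(t)$. $\|\cdot\|$ is the Euclidean norm, $\succeq$ is entrywise. QLA with parameter $V\ge1$: at each slot $t$, given $\boldsymbol U(t)$ and $S(t)=s_i$, choose $x\in\mathcal X^{(s_i)}$ maximizing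 $-Vf(s_i,x)+\sum_jU_j(t)[b_j(s_i,x)-g_j(s_i,x)]$. Dual function: $q(\boldsymbol U)=\inf_{x^{(s_i)}\in\mathcal X^{(s_i)}}\sum_{s_i}p_{s_i}\{Vf(s_i,x^{(s_i)})+\sum_jU_j[g_j(s_i,x^{(s_i)})-b_j(s_i,x^{(s_i)})]\}$; $\boldsymbol U_V^*$ denotes the maximizer of $q$ over $\boldsymbol U\succeq\boldsymbol 0$, assumed unique for every $V\ge1$. $q_0$ and $\boldsymbol U_0^*$ denote $q$ and its maximizer when $V=1$. Asymptotic notation refers to $V\to\infty$ with all other problem data fixed. *)

theory Defs
  imports "HOL-Probability.Probability" "HOL-Library.Landau_Symbols"
begin

text \<open>States range over a finite type \<open>'s\<close>, queues over a finite type \<open>'r\<close>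
  (so \<open>r = CARD('r)\<close>), backlogs are vectors in \<open>real ^ 'r\<close>.\<close>

record ('s, 'x, 'r) network =
  state_pmf :: "'s pmf"
  feasible  :: "'s \<Rightarrow> 'x set"
  cost      :: "'s \<Rightarrow> 'x \<Rightarrow> real"
  arrival   :: "'r \<Rightarrow> 's \<Rightarrow> 'x \<Rightarrow> real"
  service   :: "'r \<Rightarrow> 's \<Rightarrow> 'x \<Rightarrow> real"

definition slackness :: "('s::finite, 'x, 'r::finite) network \<Rightarrow> bool" where
  "slackness N \<longleftrightarrow>
     (\<exists>(xs :: 's \<Rightarrow> nat \<Rightarrow> 'x) (\<theta> :: 's \<Rightarrow> nat \<Rightarrow> real) \<epsilon>. 0 < \<epsilon> \<and>
        (\<forall>s. \<forall>k\<in>{1..CARD('r) + 2}. xs s k \<in> feasible N s \<and> 0 \<le> \<theta> s k) \<and>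
        (\<forall>s. (\<Sum>k = 1..CARD('r) + 2. \<theta> s k) = 1) \<and>
        (\<forall>j. (\<Sum>s\<in>UNIV. pmf (state_pmf N) s *
               (\<Sum>k = 1..CARD('r) + 2.
                  \<theta> s k * (arrival N j s (xs s k) - service N j s (xs s k)))) \<le> - \<epsilon>))"

definition queueing_network ::
    "('s::finite, 'x::topological_space, 'r::finite) network \<Rightarrow> bool" where
  "queueing_network N \<longleftrightarrow>
     (\<forall>s. compact (feasible N s)) \<and>
     ((\<forall>s. \<forall>x\<in>feasible N s. 0 \<le> cost N s x) \<or> (\<forall>s. \<forall>x\<in>feasible N s. cost N s x \<le> 0)) \<and>
     (\<forall>j s. \<forall>x\<in>feasible N s. 0 \<le> arrival N j s x \<and> 0 \<le> service N j s x) \<and>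
     (\<exists>\<delta>>0. \<forall>s. \<forall>x\<in>feasible N s. \<bar>cost N s x\<bar> \<le> \<delta> \<and>
        (\<forall>j. \<bar>arrival N j s x\<bar> \<le> \<delta> \<and> \<bar>service N j s x\<bar> \<le> \<delta>)) \<and>
     slackness N"

definition dual_fun ::
    "('s::finite, 'x, 'r::finite) network \<Rightarrow> real \<Rightarrow> real ^ 'r \<Rightarrow> real" where
  "dual_fun N V u =
     (INF x\<in>{x. \<forall>s. x s \<in> feasible N s}.
        \<Sum>s\<in>UNIV. pmf (state_pmf N) s *
          (V * cost N s (x s) + (\<Sum>j\<in>UNIV. u $ j * (arrival N j s (x s) - service N j s (x s)))))"

definition is_dual_opt ::
    "('s::finite, 'x, 'r::finite) network \<Rightarrow> real \<Rightarrow> real ^ 'r \<Rightarrow> bool" where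
  "is_dual_opt N V u \<longleftrightarrow>
     (\<forall>j. 0 \<le> u $ j) \<and> (\<forall>w. (\<forall>j. 0 \<le> w $ j) \<longrightarrow> dual_fun N V w \<le> dual_fun N V u)"

definition dual_opt ::
    "('s::finite, 'x, 'r::finite) network \<Rightarrow> real \<Rightarrow> real ^ 'r" where
  "dual_opt N V = (THE u. is_dual_opt N V u)"

definition locally_smooth :: "(real ^ 'r::finite \<Rightarrow> real) \<Rightarrow> real ^ 'r \<Rightarrow> real \<Rightarrow> real \<Rightarrow> bool" where
  "locally_smooth q u0 \<epsilon> L \<longleftrightarrow>
     (\<forall>u. (\<forall>j. 0 \<le> u $ j) \<and> norm (u - u0) < \<epsilon> \<longrightarrow> q u0 \<ge> q u + L * (norm (u - u0))\<^sup>2)"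

definition qla_weight ::
    "('s, 'x, 'r::finite) network \<Rightarrow> real \<Rightarrow> real ^ 'r \<Rightarrow> 's \<Rightarrow> 'x \<Rightarrow> real" where
  "qla_weight N V u s x =
     - V * cost N s x + (\<Sum>j\<in>UNIV. u $ j * (service N j s x - arrival N j s x))"

definition qla_choice ::
    "('s, 'x, 'r::finite) network \<Rightarrow> real \<Rightarrow> real ^ 'r \<Rightarrow> 's \<Rightarrow> 'x \<Rightarrow> bool" where
  "qla_choice N V u s x \<longleftrightarrow>
     x \<in> feasible N s \<and> (\<forall>y\<in>feasible N s. qla_weight N V u s y \<le> qla_weight N V u s x)"

abbreviation backlog_algebra ::
    "'w measure \<Rightarrow> ('w \<Rightarrow> real ^ 'r::finite) \<Rightarrow> 'w measure" where
  "backlog_algebra M u \<equiv> vimage_algebra (space M) u borel"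

text \<open>Among several maximizing actions any one may be taken, possibly depending on time, on the
  past or on additional randomization. The only causality requirement is that \<open>S t\<close> is
  independent of \<open>U t\<close>; it holds automatically when ties are broken by a fixed function of
  backlog and state, since \<open>U t\<close> is then a function of the earlier states.
  (\<open>indep_var\<close> would force both variables to have the same value type.)\<close>

definition qla_process ::
    "('s::finite, 'x, 'r::finite) network \<Rightarrow> real \<Rightarrow> 'w measure \<Rightarrow>
     (nat \<Rightarrow> 'w \<Rightarrow> 's) \<Rightarrow> (nat \<Rightarrow> 'w \<Rightarrow> 'x) \<Rightarrow> (nat \<Rightarrow> 'w \<Rightarrow> real ^ 'r) \<Rightarrow> bool" where
  "qla_process N V M S X U \<longleftrightarrow>
     prob_space M \<and>
     prob_space.indep_vars M (\<lambda>_. count_space UNIV) S UNIV \<and>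
     (\<forall>t. distr M (count_space UNIV) (S t) = measure_pmf (state_pmf N)) \<and>
     (\<forall>t. U t \<in> borel_measurable M) \<and>
     (\<forall>t. prob_space.indep_set M
            (sets (backlog_algebra M (U t)))
            (sets (vimage_algebra (space M) (S t) (count_space UNIV)))) \<and>
     (\<forall>\<omega>\<in>space M. U 0 \<omega> = 0) \<and>
     (\<forall>t. \<forall>\<omega>\<in>space M. qla_choice N V (U t \<omega>) (S t \<omega>) (X t \<omega>)) \<and>
     (\<forall>t. \<forall>\<omega>\<in>space M. \<forall>j. U (Suc t) \<omega> $ j =
        max (U t \<omega> $ j - service N j (S t \<omega>) (X t \<omega>)) 0 + arrival N j (S t \<omega>) (X t \<omega>))"

definition deviation_freq ::
    "'w measure \<Rightarrow> (nat \<Rightarrow> 'w \<Rightarrow> real ^ 'r::finite) \<Rightarrow> real ^ 'r \<Rightarrow> real \<Rightarrow> real \<Rightarrow> ereal" where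
  "deviation_freq M U u D m =
     limsup (\<lambda>t. ereal (1 / real t *
       (\<Sum>\<tau><t. measure M {\<omega> \<in> space M. norm (U \<tau> \<omega> - u) > D + m})))"

end

theory Submission
  imports Defs
begin

text \<open>
  Write \<open>u*\<close> for the dual optimum of parameter \<open>V\<close>, \<open>a\<close> for the distance of the backlog from \<open>u*\<close>,
  and \<open>K\<close> for a bound on the change of the backlog vector in one slot. The theorem rests on three facts.

  The dual function splits into a \<open>p\<close>-average of duals \<open>h s\<close>, one for each network state \<open>s\<close>, and a
  QLA action is exactly a minimizer in the definition of \<open>h s (U t)\<close>. The net flow that it
  produces is therefore a supergradient of the concave \<open>h s\<close> at \<open>U t\<close>, and expanding the square of
  the distance gives, in every outcome,
  \<open>a' \<le> a + (K\<^sup>2 + h s (U t) - h s u*) / a\<close>. As the state is independent of the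
  backlog, conditioning on \<open>U t\<close> replaces \<open>h s\<close> by the dual function \<open>q\<close>, so the
  distance drifts down as soon as the dual gap \<open>q u* - q (U t)\<close> exceeds \<open>K\<^sup>2\<close> sufficiently
  (\<open>qla_step_drift\<close>, \<open>real_cond_exp_indep_finite\<close>, \<open>conditional_drift\<close>).

  Local smoothness at \<open>V = 1\<close> makes the gap grow quadratically near the optimum, and concavity
  turns this into linear growth further out. Since \<open>q\<close> for parameter \<open>V\<close> is \<open>V\<close> times the
  function \<open>q\<close> for parameter 1 evaluated at the backlog divided by \<open>V\<close>, the gap at distance \<open>a\<close> is at
  least \<open>L a min (a / V, \<epsilon> / 2)\<close> (\<open>scaled_dual_gap\<close>). Divided by \<open>a\<close> this is of order
  \<open>1 / sqrt V\<close> once \<open>a\<close> is of order \<open>sqrt V\<close>, which is where the threshold \<open>D\<close> and the drift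
  \<open>1 / sqrt V\<close> come from.

  A process with increments at most \<open>K\<close> and drift \<open>- \<eta>\<close> above a level \<open>D\<close> has an exponential
  Lyapunov function \<open>exp (w a)\<close> with \<open>w\<close> of order \<open>\<eta> / K\<^sup>2\<close>: above \<open>D\<close> it contracts
  by the factor \<open>1 - w \<eta> / 2\<close> in the mean, below \<open>D\<close> its next value is at most
  \<open>exp (w (D + K))\<close>. Averaging over time and applying Markov's inequality bounds the frequency
  of \<open>a > D + m\<close> by \<open>2 exp (w K) / (w \<eta>)\<close> times \<open>exp (- w m)\<close>
  (\<open>exponential_tail_of_drift\<close>). With \<open>\<eta> = 1 / sqrt V\<close> the rate is of order
  \<open>1 / sqrt V\<close> and the prefactor of order \<open>V\<close>.
\<close>

section \<open>Lagrangians and duals of the single network states\<close>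

definition net_flow :: "('s, 'x, 'r::finite) network \<Rightarrow> 's \<Rightarrow> 'x \<Rightarrow> real ^ 'r" where
  "net_flow N s x = (\<chi> j. arrival N j s x - service N j s x)"

definition state_dual ::
    "('s, 'x, 'r::finite) network \<Rightarrow> real \<Rightarrow> 's \<Rightarrow> real ^ 'r \<Rightarrow> real" where
  "state_dual N V s u = (INF x\<in>feasible N s. V * cost N s x + u \<bullet> net_flow N s x)"

lemma dual_fun_eq_INF_inner:
  "dual_fun N V u = (INF x\<in>{x. \<forall>s. x s \<in> feasible N s}.
     \<Sum>s\<in>UNIV. pmf (state_pmf N) s * (V * cost N s (x s) + u \<bullet> net_flow N s (x s)))"
  by (simp add: dual_fun_def net_flow_def inner_vec_def)

lemma qla_weight_eq_inner: "qla_weight N V u s x = - (V * cost N s x + u \<bullet> net_flow N s x)"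
  by (simp add: qla_weight_def net_flow_def inner_vec_def algebra_simps sum_subtractf)

lemma norm_le_sqrt_card_mult:
  fixes v :: "real ^ 'r::finite"
  assumes "\<And>j. \<bar>v $ j\<bar> \<le> d" and "0 \<le> d"
  shows "norm v \<le> sqrt (real CARD('r)) * d"
proof -
  have "(v $ j)\<^sup>2 \<le> d\<^sup>2" for j
    using power_mono[OF assms(1)[of j], of 2] by simp
  then have "(\<Sum>j\<in>UNIV. (v $ j)\<^sup>2) \<le> (\<Sum>j\<in>(UNIV::'r set). d\<^sup>2)"
    by (intro sum_mono)
  then have "(norm v)\<^sup>2 \<le> (sqrt (real CARD('r)) * d)\<^sup>2"
    unfolding power2_norm_eq_inner by (simp add: inner_vec_def power2_eq_square[symmetric] power_mult_distrib)
  then show ?thesis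
    by (rule power2_le_imp_le) (simp add: assms)
qed

locale bounded_network =
  fixes N :: "('s::finite, 'x, 'r::finite) network" and \<delta> :: real
  assumes feasible_nonempty: "feasible N s \<noteq> {}"
    and bound_pos: "0 < \<delta>"
    and cost_bound: "x \<in> feasible N s \<Longrightarrow> \<bar>cost N s x\<bar> \<le> \<delta>"
    and arrival_nonneg: "x \<in> feasible N s \<Longrightarrow> 0 \<le> arrival N j s x"
    and arrival_le: "x \<in> feasible N s \<Longrightarrow> arrival N j s x \<le> \<delta>"
    and service_nonneg: "x \<in> feasible N s \<Longrightarrow> 0 \<le> service N j s x"
    and service_le: "x \<in> feasible N s \<Longrightarrow> service N j s x \<le> \<delta>"
begin

text \<open>Every coordinate of the backlog moves by at most \<open>\<delta>\<close> in one slot; this is the resulting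
  bound on the Euclidean norm, the constant \<open>K\<close> of the introduction.\<close>

definition max_step :: real where
  "max_step = sqrt (real CARD('r)) * \<delta>"

lemma max_step_pos: "0 < max_step"
  using bound_pos by (simp add: max_step_def)

lemma max_step_sq: "max_step\<^sup>2 = real CARD('r) * \<delta>\<^sup>2"
  by (simp add: max_step_def power_mult_distrib)

lemma norm_net_flow_le:
  assumes "x \<in> feasible N s"
  shows "norm (net_flow N s x) \<le> max_step"
  unfolding max_step_def
proof (rule norm_le_sqrt_card_mult)
  show "\<bar>net_flow N s x $ j\<bar> \<le> \<delta>" for j
    using arrival_nonneg[OF assms, of j] arrival_le[OF assms, of j]
      service_nonneg[OF assms, of j] service_le[OF assms, of j] by (simp add: net_flow_def)
qed (use bound_pos in simp)

lemma inner_net_flow_le: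
  assumes "x \<in> feasible N s"
  shows "\<bar>u \<bullet> net_flow N s x\<bar> \<le> max_step * norm u"
  using Cauchy_Schwarz_ineq2[of u "net_flow N s x"]
    mult_left_mono[OF norm_net_flow_le[OF assms] norm_ge_zero[of u]] by (simp add: mult.commute)

lemma lagrangian_bound:
  assumes "x \<in> feasible N s"
  shows "\<bar>V * cost N s x + u \<bullet> net_flow N s x\<bar> \<le> \<bar>V\<bar> * \<delta> + max_step * norm u"
  using mult_left_mono[OF cost_bound[OF assms] abs_ge_zero[of V]] inner_net_flow_le[OF assms, of u]
  by (simp add: abs_mult[symmetric])

lemma bdd_below_lagrangian:
  "bdd_below ((\<lambda>x. V * cost N s x + u \<bullet> net_flow N s x) ` feasible N s)"
proof (rule bdd_belowI2)
  show "- (\<bar>V\<bar> * \<delta> + max_step * norm u) \<le> V * cost N s x + u \<bullet> net_flow N s x"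
    if "x \<in> feasible N s" for x using lagrangian_bound[OF that, of V u] by linarith
qed

lemma state_dual_le:
  "x \<in> feasible N s \<Longrightarrow> state_dual N V s u \<le> V * cost N s x + u \<bullet> net_flow N s x"
  unfolding state_dual_def by (rule cINF_lower[OF bdd_below_lagrangian])

lemma le_state_dual:
  "(\<And>x. x \<in> feasible N s \<Longrightarrow> c \<le> V * cost N s x + u \<bullet> net_flow N s x) \<Longrightarrow> c \<le> state_dual N V s u"
  unfolding state_dual_def by (rule cINF_greatest[OF feasible_nonempty])

text \<open>Maximizing the QLA weight is minimizing the Lagrangian of the observed state, so
  the infimum is attained at the chosen action.\<close>

lemma state_dual_qla_choice:
  assumes "qla_choice N V u s x"
  shows "state_dual N V s u = V * cost N s x + u \<bullet> net_flow N s x"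
proof (rule antisym)
  show "state_dual N V s u \<le> V * cost N s x + u \<bullet> net_flow N s x"
    using assms by (intro state_dual_le) (simp add: qla_choice_def)
  show "V * cost N s x + u \<bullet> net_flow N s x \<le> state_dual N V s u"
    using assms by (intro le_state_dual) (auto simp: qla_choice_def qla_weight_eq_inner)
qed

text \<open>An infimum of affine functions whose slopes have norm at most \<open>max_step\<close>. The
  bound serves twice: it makes \<open>state_dual\<close> Borel measurable, and it keeps the quotient
  in the one-step drift bounded.\<close>

lemma state_dual_lipschitz:
  "\<bar>state_dual N V s u - state_dual N V s v\<bar> \<le> max_step * norm (u - v)"
proof -
  have *: "state_dual N V s a - max_step * norm (a - b) \<le> state_dual N V s b" for a b
  proof (rule le_state_dual)
    fix x assume x: "x \<in> feasible N s"
    have "a \<bullet> net_flow N s x - b \<bullet> net_flow N s x \<le> max_step * norm (a - b)"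
      using inner_net_flow_le[OF x, of "a - b"] by (simp add: inner_diff_left)
    then show "state_dual N V s a - max_step * norm (a - b) \<le> V * cost N s x + b \<bullet> net_flow N s x"
      using state_dual_le[OF x, of V a] by linarith
  qed
  show ?thesis using *[of u v] *[of v u] by (simp add: norm_minus_commute)
qed

lemma state_dual_measurable [measurable]: "state_dual N V s \<in> borel_measurable borel"
proof (rule borel_measurable_continuous_onI)
  have "max_step-lipschitz_on UNIV (state_dual N V s)"
    using max_step_pos by (intro lipschitz_onI) (auto simp: dist_norm state_dual_lipschitz)
  then show "continuous_on UNIV (state_dual N V s)"
    by (rule lipschitz_on_continuous_on)
qed

definition joint_lagrangian :: "real \<Rightarrow> real ^ 'r \<Rightarrow> ('s \<Rightarrow> 'x) \<Rightarrow> real" where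
  "joint_lagrangian V u x =
     (\<Sum>s\<in>UNIV. pmf (state_pmf N) s * (V * cost N s (x s) + u \<bullet> net_flow N s (x s)))"

lemma sum_state_dual_le:
  assumes "\<And>s. x s \<in> feasible N s"
  shows "(\<Sum>s\<in>UNIV. pmf (state_pmf N) s * state_dual N V s u) \<le> joint_lagrangian V u x"
  unfolding joint_lagrangian_def
  by (intro sum_mono mult_left_mono state_dual_le assms) simp

lemma dual_fun_le:
  assumes "\<And>s. x s \<in> feasible N s"
  shows "dual_fun N V u \<le> joint_lagrangian V u x"
  unfolding dual_fun_eq_INF_inner joint_lagrangian_def[symmetric]
proof (rule cINF_lower)
  show "bdd_below (joint_lagrangian V u ` {x. \<forall>s. x s \<in> feasible N s})"
    by (rule bdd_belowI2) (auto intro: sum_state_dual_le)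
qed (simp add: assms)

lemma le_dual_fun:
  assumes "\<And>x. (\<And>s. x s \<in> feasible N s) \<Longrightarrow> c \<le> joint_lagrangian V u x"
  shows "c \<le> dual_fun N V u"
  unfolding dual_fun_eq_INF_inner joint_lagrangian_def[symmetric]
proof (rule cINF_greatest)
  show "{x. \<forall>s. x s \<in> feasible N s} \<noteq> {}"
    using choice[of "\<lambda>s x. x \<in> feasible N s"] feasible_nonempty by auto
qed (auto intro: assms)

text \<open>The actions for different states are chosen independently of each other, so the infimum
  over action profiles can be taken state by state.\<close>

lemma dual_fun_eq_sum:
  "dual_fun N V u = (\<Sum>s\<in>UNIV. pmf (state_pmf N) s * state_dual N V s u)"
proof (rule antisym)
  show "(\<Sum>s\<in>UNIV. pmf (state_pmf N) s * state_dual N V s u) \<le> dual_fun N V u"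
    by (rule le_dual_fun) (rule sum_state_dual_le)
  show "dual_fun N V u \<le> (\<Sum>s\<in>UNIV. pmf (state_pmf N) s * state_dual N V s u)"
  proof (rule field_le_epsilon)
    fix e :: real assume "0 < e"
    have "\<exists>x\<in>feasible N s. V * cost N s x + u \<bullet> net_flow N s x \<le> state_dual N V s u + e" for s
    proof (rule ccontr)
      assume "\<not> ?thesis"
      then have "state_dual N V s u + e \<le> state_dual N V s u"
        by (intro le_state_dual) force
      with \<open>0 < e\<close> show False by simp
    qed
    then obtain x where x: "\<And>s. x s \<in> feasible N s"
      "\<And>s. V * cost N s (x s) + u \<bullet> net_flow N s (x s) \<le> state_dual N V s u + e"
      by metis
    have "dual_fun N V u \<le> joint_lagrangian V u x"
      by (rule dual_fun_le) (rule x)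
    also have "\<dots> \<le> (\<Sum>s\<in>UNIV. pmf (state_pmf N) s * (state_dual N V s u + e))"
      unfolding joint_lagrangian_def by (intro sum_mono mult_left_mono x) simp
    also have "\<dots> = (\<Sum>s\<in>UNIV. pmf (state_pmf N) s * state_dual N V s u) + e"
      by (simp add: distrib_left sum.distrib sum_distrib_right[symmetric] sum_pmf_eq_1)
    finally show "dual_fun N V u \<le> (\<Sum>s\<in>UNIV. pmf (state_pmf N) s * state_dual N V s u) + e" .
  qed
qed

section \<open>Growth of the dual gap\<close>

text \<open>The Lagrangian is jointly homogeneous in the penalty parameter and the backlog. This
  reduces every \<open>V\<close> to \<open>V = 1\<close>, where the smoothness assumption lives.\<close>

lemma dual_fun_scale:
  assumes "0 < V"
  shows "dual_fun N V (V *\<^sub>R u) = V * dual_fun N 1 u"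
proof -
  have L: "joint_lagrangian V (V *\<^sub>R u) x = V * joint_lagrangian 1 u x" for x
    by (simp add: joint_lagrangian_def sum_distrib_left algebra_simps)
  show ?thesis
  proof (rule antisym)
    show "V * dual_fun N 1 u \<le> dual_fun N V (V *\<^sub>R u)"
      using assms by (intro le_dual_fun) (simp add: L dual_fun_le)
    have "dual_fun N V (V *\<^sub>R u) / V \<le> dual_fun N 1 u"
      using assms dual_fun_le[of _ V "V *\<^sub>R u"]
      by (intro le_dual_fun) (simp add: L divide_le_eq mult.commute)
    then show "dual_fun N V (V *\<^sub>R u) \<le> V * dual_fun N 1 u"
      using assms by (simp add: divide_le_eq mult.commute)
  qed
qed

lemma dual_fun_concave:
  assumes "0 \<le> l" "l \<le> 1"
  shows "(1 - l) * dual_fun N V u + l * dual_fun N V v \<le> dual_fun N V ((1 - l) *\<^sub>R u + l *\<^sub>R v)"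
proof (rule le_dual_fun)
  fix x assume x: "\<And>s. x s \<in> feasible N s"
  have "joint_lagrangian V ((1 - l) *\<^sub>R u + l *\<^sub>R v) x
      = (1 - l) * joint_lagrangian V u x + l * joint_lagrangian V v x"
    unfolding joint_lagrangian_def sum_distrib_left sum.distrib[symmetric]
    by (intro sum.cong refl) (simp add: inner_add_left algebra_simps)
  then show "(1 - l) * dual_fun N V u + l * dual_fun N V v
      \<le> joint_lagrangian V ((1 - l) *\<^sub>R u + l *\<^sub>R v) x"
    using assms dual_fun_le[OF x, of V u] dual_fun_le[OF x, of V v]
    by (simp add: add_mono mult_left_mono)
qed

lemma dual_opt_scale:
  assumes unique: "\<exists>!u. is_dual_opt N 1 u" "\<exists>!u. is_dual_opt N V u" and V: "0 < V"
  shows "dual_opt N V = V *\<^sub>R dual_opt N 1"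
proof -
  have opt: "is_dual_opt N 1 (dual_opt N 1)"
    unfolding dual_opt_def by (rule theI'[OF unique(1)])
  have "is_dual_opt N V (V *\<^sub>R dual_opt N 1)"
    unfolding is_dual_opt_def
  proof (intro conjI allI impI)
    show "0 \<le> (V *\<^sub>R dual_opt N 1) $ j" for j
      using opt V by (simp add: is_dual_opt_def)
    fix w :: "real ^ 'r" assume "\<forall>j. 0 \<le> w $ j"
    then have "dual_fun N 1 (w /\<^sub>R V) \<le> dual_fun N 1 (dual_opt N 1)"
      using opt V by (auto simp: is_dual_opt_def)
    then show "dual_fun N V w \<le> dual_fun N V (V *\<^sub>R dual_opt N 1)"
      using V dual_fun_scale[OF V, of "w /\<^sub>R V"] dual_fun_scale[OF V, of "dual_opt N 1"] by simp
  qed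
  then show ?thesis
    unfolding dual_opt_def[of N V] by (rule the1_equality[OF unique(2)])
qed

text \<open>Within \<open>\<epsilon> / 2\<close> this is the smoothness assumption. Further out, the point on the segment
  at distance \<open>\<epsilon> / 2\<close> from \<open>u0\<close> has gap at least \<open>L (\<epsilon> / 2)\<^sup>2\<close>, and by concavity the gap
  grows at least proportionally beyond it. The radius is \<open>\<epsilon> / 2\<close> because
  the assumption only covers distances strictly less than \<open>\<epsilon>\<close>.\<close>

lemma dual_gap_of_locally_smooth:
  assumes smooth: "locally_smooth (dual_fun N V) u0 \<epsilon> L" and pos: "0 < \<epsilon>" "0 < L"
    and nonneg: "\<And>j. 0 \<le> u0 $ j" "\<And>j. 0 \<le> u $ j"
  shows "L * min (norm (u - u0)) (\<epsilon> / 2) * norm (u - u0) \<le> dual_fun N V u0 - dual_fun N V u"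
proof (cases "norm (u - u0) \<le> \<epsilon> / 2")
  case True
  then have "norm (u - u0) < \<epsilon>" using pos by simp
  then have "dual_fun N V u + L * (norm (u - u0))\<^sup>2 \<le> dual_fun N V u0"
    using smooth nonneg(2) by (auto simp: locally_smooth_def)
  then show ?thesis
    using True by (simp add: power2_eq_square mult.assoc)
next
  case False
  \<comment> \<open>\<open>v\<close> is the point of the segment from \<open>u0\<close> to \<open>u\<close> at distance \<open>\<epsilon> / 2\<close> from \<open>u0\<close>.\<close>
  define l where "l = \<epsilon> / 2 / norm (u - u0)"
  have n: "0 < norm (u - u0)" using False pos by linarith
  have l: "0 < l" "l \<le> 1" using False pos n by (auto simp: l_def divide_le_eq)
  have ln: "l * norm (u - u0) = \<epsilon> / 2" using n by (simp add: l_def)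
  define v where "v = (1 - l) *\<^sub>R u0 + l *\<^sub>R u"
  have vu: "v - u0 = l *\<^sub>R (u - u0)" by (simp add: v_def algebra_simps)
  have nv: "norm (v - u0) = \<epsilon> / 2" using l ln by (simp add: vu)
  have "0 \<le> v $ j" for j using l nonneg by (simp add: v_def)
  then have "dual_fun N V v + L * (\<epsilon> / 2)\<^sup>2 \<le> dual_fun N V u0"
    using smooth nv pos by (auto simp: locally_smooth_def)
  with dual_fun_concave[of l V u0 u] l
  have "L * (\<epsilon> / 2)\<^sup>2 \<le> l * (dual_fun N V u0 - dual_fun N V u)"
    by (simp add: v_def algebra_simps)
  also have "L * (\<epsilon> / 2)\<^sup>2 = L * (\<epsilon> / 2) * (l * norm (u - u0))"
    by (simp only: ln power2_eq_square mult.assoc)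
  also have "\<dots> = l * (L * (\<epsilon> / 2) * norm (u - u0))"
    by (simp only: ac_simps)
  finally have "l * (L * (\<epsilon> / 2) * norm (u - u0)) \<le> l * (dual_fun N V u0 - dual_fun N V u)" .
  then show ?thesis using l False by simp
qed

lemma scaled_dual_gap:
  assumes smooth: "locally_smooth (dual_fun N 1) u0 \<epsilon> L" and pos: "0 < \<epsilon>" "0 < L" "0 < V"
    and nonneg: "\<And>j. 0 \<le> u0 $ j" "\<And>j. 0 \<le> u $ j"
  shows "L * min (norm (u - V *\<^sub>R u0) / V) (\<epsilon> / 2) * norm (u - V *\<^sub>R u0)
    \<le> dual_fun N V (V *\<^sub>R u0) - dual_fun N V u"
proof -
  have "u /\<^sub>R V - u0 = (u - V *\<^sub>R u0) /\<^sub>R V"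
    using pos by (simp add: scaleR_diff_right)
  then have n: "norm (u /\<^sub>R V - u0) = norm (u - V *\<^sub>R u0) / V"
    using pos by (simp add: divide_inverse mult.commute)
  have "L * min (norm (u - V *\<^sub>R u0) / V) (\<epsilon> / 2) * (norm (u - V *\<^sub>R u0) / V)
      \<le> dual_fun N 1 u0 - dual_fun N 1 (u /\<^sub>R V)"
    using dual_gap_of_locally_smooth[OF smooth pos(1,2) nonneg(1), of "u /\<^sub>R V"] nonneg(2) pos
    by (simp add: n)
  then have "V * (L * min (norm (u - V *\<^sub>R u0) / V) (\<epsilon> / 2) * (norm (u - V *\<^sub>R u0) / V))
      \<le> V * (dual_fun N 1 u0 - dual_fun N 1 (u /\<^sub>R V))"
    using pos by (intro mult_left_mono) auto
  then show ?thesis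
    using pos dual_fun_scale[OF pos(3), of u0] dual_fun_scale[OF pos(3), of "u /\<^sub>R V"]
    by (simp add: right_diff_distrib)
qed

section \<open>One slot of the queue dynamics\<close>

text \<open>Clipping at 0 is a projection onto the half-line that contains \<open>w $ j\<close>, so it does not
  increase the distance to \<open>w\<close>; in the cross term with the arrivals it is dominated by
  \<open>u $ j\<close>, because both the backlog and the service are nonnegative.\<close>

lemma queue_step_distance:
  fixes u w u' :: "real ^ 'r"
  assumes x: "x \<in> feasible N s"
    and u: "\<And>j. 0 \<le> u $ j" and w: "\<And>j. 0 \<le> w $ j"
    and u': "\<And>j. u' $ j = max (u $ j - service N j s x) 0 + arrival N j s x"
  shows "(norm (u' - w))\<^sup>2 \<le> (norm (u - w))\<^sup>2 + 2 * max_step\<^sup>2 + 2 * ((u - w) \<bullet> net_flow N s x)"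
proof -
  have "(u' $ j - w $ j)\<^sup>2 \<le> (u $ j - w $ j)\<^sup>2 + 2 * \<delta>\<^sup>2
      + 2 * ((u $ j - w $ j) * (arrival N j s x - service N j s x))" for j
  proof -
    let ?a = "arrival N j s x" and ?b = "service N j s x" and ?m = "max (u $ j - service N j s x) 0"
    note bounds = arrival_nonneg[OF x, of j] arrival_le[OF x, of j]
      service_nonneg[OF x, of j] service_le[OF x, of j]
    have "(?m - w $ j)\<^sup>2 \<le> (u $ j - ?b - w $ j)\<^sup>2"
      using w[of j] by (auto simp: max_def intro!: abs_le_square_iff[THEN iffD1])
    moreover have "?a * (?m - w $ j) \<le> ?a * (u $ j - w $ j)"
      using bounds u[of j] by (intro mult_left_mono) auto
    moreover have "?a\<^sup>2 \<le> \<delta>\<^sup>2" "?b\<^sup>2 \<le> \<delta>\<^sup>2"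
      using bounds by (auto intro: power_mono)
    ultimately show ?thesis
      unfolding u' by (simp add: power2_eq_square algebra_simps)
  qed
  then have "(\<Sum>j\<in>UNIV. (u' $ j - w $ j)\<^sup>2) \<le> (\<Sum>j\<in>UNIV. (u $ j - w $ j)\<^sup>2 + 2 * \<delta>\<^sup>2
      + 2 * ((u $ j - w $ j) * (arrival N j s x - service N j s x)))"
    by (intro sum_mono)
  then show ?thesis
    unfolding power2_norm_eq_inner max_step_sq
    by (simp add: inner_vec_def net_flow_def sum.distrib sum_distrib_left power2_eq_square)
qed

lemma queue_step_norm_le:
  fixes u u' :: "real ^ 'r"
  assumes x: "x \<in> feasible N s" and u: "\<And>j. 0 \<le> u $ j"
    and u': "\<And>j. u' $ j = max (u $ j - service N j s x) 0 + arrival N j s x"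
  shows "norm (u' - u) \<le> max_step"
  unfolding max_step_def
proof (rule norm_le_sqrt_card_mult)
  fix j
  show "\<bar>(u' - u) $ j\<bar> \<le> \<delta>"
    using arrival_nonneg[OF x, of j] arrival_le[OF x, of j] u[of j]
      service_nonneg[OF x, of j] service_le[OF x, of j] by (auto simp: u' max_def)
qed (use bound_pos in simp)

text \<open>The net flow of the chosen action is a supergradient of the concave function \<open>state_dual N V s\<close>
  at \<open>u\<close>, which bounds the inner product in \<open>queue_step_distance\<close> by a difference of values.
  The square root is removed by \<open>2 a y \<le> a\<^sup>2 + y\<^sup>2\<close>. The bound involves the
  outcome only through the state and the current backlog, which are independent.\<close>

lemma qla_step_drift:
  fixes u w u' :: "real ^ 'r"
  assumes qla: "qla_choice N V u s x"
    and u: "\<And>j. 0 \<le> u $ j" and w: "\<And>j. 0 \<le> w $ j"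
    and u': "\<And>j. u' $ j = max (u $ j - service N j s x) 0 + arrival N j s x"
    and neq: "0 < norm (u - w)"
  shows "norm (u' - w) \<le>
    norm (u - w) + (max_step\<^sup>2 + state_dual N V s u - state_dual N V s w) / norm (u - w)"
proof -
  let ?a = "norm (u - w)" and ?y = "norm (u' - w)"
  have x: "x \<in> feasible N s" using qla by (simp add: qla_choice_def)
  have "(u - w) \<bullet> net_flow N s x \<le> state_dual N V s u - state_dual N V s w"
    using state_dual_le[OF x, of V w] state_dual_qla_choice[OF qla] by (simp add: inner_diff_left)
  with queue_step_distance[OF x u w u']
  have "?y\<^sup>2 \<le> ?a\<^sup>2 + 2 * (max_step\<^sup>2 + state_dual N V s u - state_dual N V s w)"
    by (simp add: algebra_simps)
  moreover have "2 * (?a * ?y) \<le> ?a\<^sup>2 + ?y\<^sup>2"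
    using zero_le_power2[of "?a - ?y"] unfolding power2_diff by (simp add: ac_simps)
  ultimately have "2 * (?a * ?y) \<le>
      2 * (?a\<^sup>2 + (max_step\<^sup>2 + state_dual N V s u - state_dual N V s w))"
    by (simp add: distrib_left)
  then have "?a * ?y \<le> ?a * ?a + (max_step\<^sup>2 + state_dual N V s u - state_dual N V s w)"
    by (simp add: power2_eq_square)
  then have "?y \<le> (?a * ?a + (max_step\<^sup>2 + state_dual N V s u - state_dual N V s w)) / ?a"
    using neq by (simp add: pos_le_divide_eq mult.commute)
  then show ?thesis using neq by (simp add: add_divide_distrib)
qed

end

section \<open>Conditional expectation given an independent variable\<close>

text \<open>Expand over the values of \<open>S\<close>: on \<open>S = s\<close> the integrand is \<open>\<phi> s (U \<omega>)\<close> times the indicator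
  of \<open>S = s\<close>. The first factor is measurable in the conditioning algebra and can be pulled out,
  and independence makes the conditional probability of the second one constant.\<close>

lemma (in prob_space) real_cond_exp_indep_finite:
  fixes S :: "'a \<Rightarrow> 's::finite" and U :: "'a \<Rightarrow> 'b::topological_space" and \<phi> :: "'s \<Rightarrow> 'b \<Rightarrow> real"
  assumes U [measurable]: "U \<in> borel_measurable M"
    and S [measurable]: "S \<in> measurable M (count_space UNIV)"
    and indep: "indep_set (sets (vimage_algebra (space M) U borel))
      (sets (vimage_algebra (space M) S (count_space UNIV)))"
    and \<phi> [measurable]: "\<And>s. \<phi> s \<in> borel_measurable borel"
    and int: "\<And>s. integrable M (\<lambda>\<omega>. \<phi> s (U \<omega>))"
  shows "AE \<omega> in M. real_cond_exp M (vimage_algebra (space M) U borel) (\<lambda>\<omega>. \<phi> (S \<omega>) (U \<omega>)) \<omega>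
    = (\<Sum>s\<in>UNIV. prob {\<omega> \<in> space M. S \<omega> = s} * \<phi> s (U \<omega>))"
proof -
  let ?F = "vimage_algebra (space M) U borel"
  interpret finite_measure_subalgebra M ?F
  proof
    show "subalgebra M ?F"
      using measurable_sets[OF U] by (auto simp: subalgebra_def sets_vimage_algebra2)
  qed
  let ?I = "\<lambda>s \<omega>. indicator {s} (S \<omega>) :: real"
  have UF: "U \<in> borel_measurable ?F" by (rule measurable_vimage_algebra1) simp
  have \<phi>F: "(\<lambda>\<omega>. \<phi> s (U \<omega>)) \<in> borel_measurable ?F" for s
    by (rule measurable_compose[OF UF \<phi>])
  have int_prod: "integrable M (\<lambda>\<omega>. \<phi> s (U \<omega>) * ?I s \<omega>)" for s
    by (rule Bochner_Integration.integrable_bound[OF int[of s]]) (auto simp: indicator_def)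
  have cond_I: "AE \<omega> in M. real_cond_exp M ?F (?I s) \<omega> = prob {\<omega> \<in> space M. S \<omega> = s}" for s
  proof (rule real_cond_exp_charact)
    fix A assume A: "A \<in> sets ?F"
    then have [measurable]: "A \<in> sets M" using subalg by (auto simp: subalgebra_def)
    have B: "{\<omega> \<in> space M. S \<omega> = s} \<in> sets (vimage_algebra (space M) S (count_space UNIV))"
      using in_vimage_algebra[of "{s}" "count_space UNIV" S "space M"]
      by (simp add: vimage_def Int_def conj_commute)
    have "(\<integral>\<omega>\<in>A. ?I s \<omega> \<partial>M) = (\<integral>\<omega>. indicator (A \<inter> {\<omega> \<in> space M. S \<omega> = s}) \<omega> \<partial>M)"
      unfolding set_lebesgue_integral_def
      by (intro Bochner_Integration.integral_cong) (auto simp: indicator_def)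
    also have "\<dots> = prob (A \<inter> {\<omega> \<in> space M. S \<omega> = s})" by simp
    also have "\<dots> = prob A * prob {\<omega> \<in> space M. S \<omega> = s}"
      by (rule indep_setD[OF indep A B])
    also have "\<dots> = (\<integral>\<omega>\<in>A. prob {\<omega> \<in> space M. S \<omega> = s} \<partial>M)"
      unfolding set_lebesgue_integral_def by simp
    finally show "(\<integral>\<omega>\<in>A. ?I s \<omega> \<partial>M) = (\<integral>\<omega>\<in>A. prob {\<omega> \<in> space M. S \<omega> = s} \<partial>M)" .
  next
    show "integrable M (?I s)"
      by (rule integrable_const_bound[of _ 1]) (auto simp: indicator_def)
  qed auto
  have "AE \<omega> in M. real_cond_exp M ?F (\<lambda>\<omega>. \<phi> s (U \<omega>) * ?I s \<omega>) \<omega>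
      = prob {\<omega> \<in> space M. S \<omega> = s} * \<phi> s (U \<omega>)" for s
    using real_cond_exp_mult[OF \<phi>F _ int_prod, of s] cond_I[of s] by auto
  then have "AE \<omega> in M. \<forall>s\<in>UNIV. real_cond_exp M ?F (\<lambda>\<omega>. \<phi> s (U \<omega>) * ?I s \<omega>) \<omega>
      = prob {\<omega> \<in> space M. S \<omega> = s} * \<phi> s (U \<omega>)"
    by (subst AE_ball_countable) auto
  moreover have "AE \<omega> in M. real_cond_exp M ?F (\<lambda>\<omega>. \<Sum>s\<in>UNIV. \<phi> s (U \<omega>) * ?I s \<omega>) \<omega>
      = (\<Sum>s\<in>UNIV. real_cond_exp M ?F (\<lambda>\<omega>. \<phi> s (U \<omega>) * ?I s \<omega>) \<omega>)"
    by (rule real_cond_exp_sum[OF int_prod])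
  moreover have "(\<Sum>s\<in>UNIV. \<phi> s (U \<omega>) * ?I s \<omega>) = \<phi> (S \<omega>) (U \<omega>)" for \<omega>
    by (simp add: indicator_def if_distrib cong: if_cong)
  ultimately show ?thesis by auto
qed

section \<open>Exponential tails from negative drift\<close>

lemma exp_le_quadratic:
  fixes x :: real
  assumes "\<bar>x\<bar> \<le> 1"
  shows "exp x \<le> 1 + x + x\<^sup>2"
proof (cases "0 \<le> x")
  case True
  then show ?thesis using assms by (intro exp_bound) auto
next
  case False
  define y where "y = - x"
  have y: "0 \<le> y" using False by (simp add: y_def)
  \<comment> \<open>For negative arguments, multiply the claim by \<open>exp y\<close> and bound that from below by its
    quadratic Taylor polynomial.\<close>
  have "1 \<le> (1 - y + y\<^sup>2) * (1 + y + y\<^sup>2 / 2)"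
  proof -
    have "(1 - y + y\<^sup>2) * (1 + y + y\<^sup>2 / 2) = 1 + (y\<^sup>2 + y ^ 3 + y ^ 4) / 2"
      by (simp add: field_simps power2_eq_square power3_eq_cube power4_eq_xxxx)
    then show ?thesis using y by simp
  qed
  also have "\<dots> \<le> (1 - y + y\<^sup>2) * exp y"
  proof (rule mult_left_mono)
    show "1 + y + y\<^sup>2 / 2 \<le> exp y" by (rule exp_lower_Taylor_quadratic[OF y])
    show "0 \<le> 1 - y + y\<^sup>2" using assms y by (simp add: y_def)
  qed
  finally show ?thesis by (simp add: y_def exp_minus field_simps)
qed

text \<open>With \<open>Y = exp (w Z)\<close> and \<open>\<kappa> = w \<eta> / 2\<close>, the bound \<open>exp x \<le> 1 + x + x\<^sup>2\<close> and the drift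
  give \<open>E Y' \<le> (1 - w \<eta> + w\<^sup>2 K\<^sup>2) E Y\<close> on the part above \<open>D\<close>; the condition
  \<open>2 w K\<^sup>2 \<le> \<eta>\<close> lets half of the drift absorb the quadratic term. Below \<open>D\<close>
  the next value is at most \<open>C = exp (w (D + K))\<close>. Hence \<open>E Y' \<le> (1 - \<kappa>) E Y + C\<close>,
  and summing over time bounds the time averages of \<open>E Y\<close> by \<open>C / \<kappa>\<close> up to
  a term that vanishes in the limit.\<close>

lemma (in prob_space) exponential_tail_of_drift:
  fixes Z :: "nat \<Rightarrow> 'a \<Rightarrow> real" and F :: "nat \<Rightarrow> 'a measure"
  assumes sub: "\<And>t. subalgebra M (F t)"
    and adapted: "\<And>t. Z t \<in> borel_measurable (F t)"
    and start: "\<And>\<omega>. \<omega> \<in> space M \<Longrightarrow> Z 0 \<omega> = z0"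
    and step: "\<And>t \<omega>. \<omega> \<in> space M \<Longrightarrow> \<bar>Z (Suc t) \<omega> - Z t \<omega>\<bar> \<le> K"
    and drift: "\<And>t. AE \<omega> in M. D \<le> Z t \<omega> \<longrightarrow> real_cond_exp M (F t) (Z (Suc t)) \<omega> \<le> Z t \<omega> - \<eta>"
    and w: "0 < w" "w * K \<le> 1" "2 * w * K\<^sup>2 \<le> \<eta>" "w * \<eta> \<le> 2" and \<eta>: "0 < \<eta>" 
  shows "limsup (\<lambda>t. ereal (1 / real t * (\<Sum>\<tau><t. prob {\<omega> \<in> space M. D + m < Z \<tau> \<omega>})))
    \<le> ereal (2 * exp (w * K) / (w * \<eta>) * exp (- w * m))"
proof -
  have [measurable]: "Z t \<in> borel_measurable M" for t
    by (rule measurable_from_subalg[OF sub adapted])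
  have Z_bound: "\<bar>Z t \<omega> - z0\<bar> \<le> real t * K" if "\<omega> \<in> space M" for t \<omega>
  proof (induction t)
    case (Suc t)
    then show ?case using step[OF that, of t] by (simp add: algebra_simps)
  qed (simp add: start that)
  define Y where "Y t \<omega> = exp (w * Z t \<omega>)" for t \<omega>
  have [measurable]: "Y t \<in> borel_measurable M" for t unfolding Y_def by measurable
  have Y_pos: "0 < Y t \<omega>" for t \<omega> by (simp add: Y_def)
  have Z_le: "\<bar>Z t \<omega>\<bar> \<le> \<bar>z0\<bar> + real t * K" if "\<omega> \<in> space M" for t \<omega>
    using Z_bound[OF that, of t] by linarith
  have Y_le: "Y t \<omega> \<le> exp (w * (\<bar>z0\<bar> + real t * K))" if "\<omega> \<in> space M" for t \<omega>
    using Z_le[OF that, of t] w(1) by (auto simp: Y_def)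
  define I where "I t \<omega> = (indicator {D..} (Z t \<omega>) :: real)" for t \<omega>
  have [measurable]: "I t \<in> borel_measurable M" for t unfolding I_def by measurable
  have I_bound: "0 \<le> I t \<omega>" "I t \<omega> \<le> 1" for t \<omega> by (auto simp: I_def indicator_def)
  have I_Y_le: "I t \<omega> * Y t \<omega> \<le> exp (w * (\<bar>z0\<bar> + real t * K))" if "\<omega> \<in> space M" for t \<omega>
    using mult_right_mono[OF I_bound(2)[of t \<omega>] less_imp_le[OF Y_pos[of t \<omega>]]] Y_le[OF that, of t]
    by simp
  have int_Y: "integrable M (Y t)" for t
    using Y_le Y_pos by (intro integrable_const_bound[of _ "exp (w * (\<bar>z0\<bar> + real t * K))"])
      (auto simp: less_imp_le)
  have int_IY: "integrable M (\<lambda>\<omega>. I t \<omega> * Y t \<omega>)" for t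
    using I_Y_le I_bound Y_pos by (intro integrable_const_bound[of _ "exp (w * (\<bar>z0\<bar> + real t * K))"])
      (auto simp: less_imp_le abs_mult)
  have int_IYZ: "integrable M (\<lambda>\<omega>. I t \<omega> * Y t \<omega> * Z u \<omega>)" for t u
  proof (rule integrable_const_bound)
    show "AE \<omega> in M. norm (I t \<omega> * Y t \<omega> * Z u \<omega>)
        \<le> exp (w * (\<bar>z0\<bar> + real t * K)) * (\<bar>z0\<bar> + real u * K)"
    proof (rule AE_I2)
      fix \<omega> assume \<omega>: "\<omega> \<in> space M"
      have "norm (I t \<omega> * Y t \<omega> * Z u \<omega>) = I t \<omega> * Y t \<omega> * \<bar>Z u \<omega>\<bar>"
        using I_bound(1)[of t \<omega>] Y_pos[of t \<omega>] by (simp add: abs_mult)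
      also have "\<dots> \<le> exp (w * (\<bar>z0\<bar> + real t * K)) * (\<bar>z0\<bar> + real u * K)"
        using I_bound(1)[of t \<omega>] Y_pos[of t \<omega>] by (intro mult_mono I_Y_le Z_le \<omega>) auto
      finally show "norm (I t \<omega> * Y t \<omega> * Z u \<omega>)
        \<le> exp (w * (\<bar>z0\<bar> + real t * K)) * (\<bar>z0\<bar> + real u * K)" .
    qed
  qed measurable
  define \<kappa> where "\<kappa> = w * \<eta> / 2"
  have \<kappa>: "0 < \<kappa>" "\<kappa> \<le> 1" using w \<eta> by (auto simp: \<kappa>_def)
  define C where "C = exp (w * (D + K))"
  define E where "E t = expectation (Y t)" for t
  have E_nonneg: "0 \<le> E t" for t
    unfolding E_def by (intro integral_nonneg_AE) (auto simp: Y_pos less_imp_le)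
  have wK: "w\<^sup>2 * K\<^sup>2 \<le> \<kappa>"
    using mult_left_mono[OF w(3), of "w / 2"] w(1) by (simp add: \<kappa>_def power2_eq_square)
  \<comment> \<open>The pointwise form of the recursion. It is kept linear in \<open>Z (Suc t)\<close>, so that the
    conditional drift bound can be inserted under the integral.\<close>
  have Y_step: "Y (Suc t) \<omega> \<le> (1 - \<kappa>) * (Y t \<omega> - I t \<omega> * Y t \<omega>) + C
      + (1 + \<kappa>) * (I t \<omega> * Y t \<omega>) - w * (I t \<omega> * Y t \<omega> * Z t \<omega>)
      + w * (I t \<omega> * Y t \<omega> * Z (Suc t) \<omega>)" if \<omega>: "\<omega> \<in> space M" for t \<omega>
  proof (cases "D \<le> Z t \<omega>")
    case True
    define x where "x = w * (Z (Suc t) \<omega> - Z t \<omega>)"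
    have x: "\<bar>x\<bar> \<le> w * K"
      using step[OF \<omega>, of t] w(1) by (simp add: x_def abs_mult)
    then have "x\<^sup>2 \<le> (w * K)\<^sup>2" using power_mono[OF x, of 2] by simp
    then have "exp x \<le> 1 + x + \<kappa>"
      using exp_le_quadratic[of x] x w(2) wK by (simp add: power_mult_distrib)
    then have "Y t \<omega> * exp x \<le> Y t \<omega> * (1 + x + \<kappa>)"
      using Y_pos[of t \<omega>] by (intro mult_left_mono) auto
    moreover have "Y (Suc t) \<omega> = Y t \<omega> * exp x"
      by (simp add: Y_def x_def exp_add[symmetric] algebra_simps)
    moreover have "0 < C" by (simp add: C_def)
    moreover have "I t \<omega> = 1" using True by (simp add: I_def)
    ultimately show ?thesis by (simp add: x_def algebra_simps)
  next
    case False
    then have "Z (Suc t) \<omega> \<le> D + K" using step[OF \<omega>, of t] by linarith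
    then have "Y (Suc t) \<omega> \<le> C" using w(1) by (simp add: Y_def C_def)
    moreover have "0 \<le> (1 - \<kappa>) * Y t \<omega>" using \<kappa> Y_pos[of t \<omega>] by simp
    moreover have "I t \<omega> = 0" using False by (simp add: I_def)
    ultimately show ?thesis by simp
  qed
  have E_step: "E (Suc t) \<le> (1 - \<kappa>) * E t + C" for t
  proof -
    interpret finite_measure_subalgebra M "F t" by standard (rule sub)
    note [simp] = int_Y int_IY int_IYZ
    have [measurable]: "(\<lambda>\<omega>. I t \<omega> * Y t \<omega>) \<in> borel_measurable (F t)"
      unfolding I_def Y_def using adapted[of t] by measurable
    let ?c = "real_cond_exp M (F t) (Z (Suc t))"
    have int_c: "integrable M (\<lambda>\<omega>. I t \<omega> * Y t \<omega> * ?c \<omega>)"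
      and eq_c: "(\<integral>\<omega>. I t \<omega> * Y t \<omega> * ?c \<omega> \<partial>M) = (\<integral>\<omega>. I t \<omega> * Y t \<omega> * Z (Suc t) \<omega> \<partial>M)"
      by (rule real_cond_exp_intg; simp)+
    have "(\<integral>\<omega>. I t \<omega> * Y t \<omega> * ?c \<omega> \<partial>M)
        \<le> (\<integral>\<omega>. I t \<omega> * Y t \<omega> * Z t \<omega> - \<eta> * (I t \<omega> * Y t \<omega>) \<partial>M)"
    proof (rule integral_mono_AE)
      show "AE \<omega> in M. I t \<omega> * Y t \<omega> * ?c \<omega> \<le> I t \<omega> * Y t \<omega> * Z t \<omega> - \<eta> * (I t \<omega> * Y t \<omega>)"
        using drift[of t]
      proof eventually_elim
        case (elim \<omega>)
        show ?case
        proof (cases "D \<le> Z t \<omega>")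
          case True
          then have "Y t \<omega> * ?c \<omega> \<le> Y t \<omega> * (Z t \<omega> - \<eta>)"
            using elim Y_pos[of t \<omega>] by (intro mult_left_mono) auto
          then show ?thesis using True by (simp add: I_def algebra_simps)
        qed (simp add: I_def)
      qed
    qed (use int_c in simp_all)
    also have "\<dots> = (\<integral>\<omega>. I t \<omega> * Y t \<omega> * Z t \<omega> \<partial>M) - \<eta> * (\<integral>\<omega>. I t \<omega> * Y t \<omega> \<partial>M)"
      by simp
    finally have c_le: "w * (\<integral>\<omega>. I t \<omega> * Y t \<omega> * Z (Suc t) \<omega> \<partial>M)
        \<le> w * ((\<integral>\<omega>. I t \<omega> * Y t \<omega> * Z t \<omega> \<partial>M) - \<eta> * (\<integral>\<omega>. I t \<omega> * Y t \<omega> \<partial>M))"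
      using w(1) by (simp add: eq_c)
    have "E (Suc t) \<le> (\<integral>\<omega>. (1 - \<kappa>) * (Y t \<omega> - I t \<omega> * Y t \<omega>) + C
        + (1 + \<kappa>) * (I t \<omega> * Y t \<omega>) - w * (I t \<omega> * Y t \<omega> * Z t \<omega>)
        + w * (I t \<omega> * Y t \<omega> * Z (Suc t) \<omega>) \<partial>M)"
      unfolding E_def by (rule integral_mono) (auto intro: Y_step)
    also have "\<dots> = (1 - \<kappa>) * (E t - (\<integral>\<omega>. I t \<omega> * Y t \<omega> \<partial>M)) + C
        + (1 + \<kappa>) * (\<integral>\<omega>. I t \<omega> * Y t \<omega> \<partial>M) - w * (\<integral>\<omega>. I t \<omega> * Y t \<omega> * Z t \<omega> \<partial>M)
        + w * (\<integral>\<omega>. I t \<omega> * Y t \<omega> * Z (Suc t) \<omega> \<partial>M)"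
      by (simp add: E_def prob_space)
    also have "\<dots> \<le> (1 - \<kappa>) * E t + C"
      using c_le by (simp add: \<kappa>_def algebra_simps)
    finally show ?thesis .
  qed
  \<comment> \<open>Telescoping the recursion gives time averages directly.\<close>
  have E_sum: "\<kappa> * (\<Sum>\<tau><t. E \<tau>) + E t \<le> E 0 + real t * C" for t
  proof (induction t)
    case (Suc t)
    then show ?case using E_step[of t] by (simp add: algebra_simps)
  qed simp
  define G where "G = exp (- (w * (D + m)))"
  have tail: "prob {\<omega> \<in> space M. D + m < Z t \<omega>} \<le> G * E t" for t
  proof -
    have "prob {\<omega> \<in> space M. D + m < Z t \<omega>} = (\<integral>\<omega>. indicator {\<omega> \<in> space M. D + m < Z t \<omega>} \<omega> \<partial>M)"
      by simp
    also have "\<dots> \<le> (\<integral>\<omega>. G * Y t \<omega> \<partial>M)"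
    proof (rule integral_mono)
      fix \<omega> assume "\<omega> \<in> space M"
      have "1 \<le> G * Y t \<omega>" if "D + m < Z t \<omega>"
        using that w(1) by (simp add: G_def Y_def exp_add[symmetric])
      then show "indicator {\<omega> \<in> space M. D + m < Z t \<omega>} \<omega> \<le> G * Y t \<omega>"
        using Y_pos[of t \<omega>] by (auto simp: indicator_def G_def)
    next
      show "integrable M (indicator {\<omega> \<in> space M. D + m < Z t \<omega>} :: 'a \<Rightarrow> real)"
        by (rule integrable_const_bound[of _ 1]) auto
    qed (simp add: int_Y)
    finally show ?thesis by (simp add: E_def)
  qed
  have avg: "1 / real t * (\<Sum>\<tau><t. prob {\<omega> \<in> space M. D + m < Z \<tau> \<omega>})
      \<le> G * E 0 / \<kappa> * (1 / real t) + G * C / \<kappa>" if "0 < t" for t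
  proof -
    have "(\<Sum>\<tau><t. E \<tau>) \<le> (E 0 + real t * C) / \<kappa>"
      using E_sum[of t] E_nonneg[of t] \<kappa>(1) by (simp add: pos_le_divide_eq mult.commute)
    have "(\<Sum>\<tau><t. prob {\<omega> \<in> space M. D + m < Z \<tau> \<omega>}) \<le> (\<Sum>\<tau><t. G * E \<tau>)"
      by (intro sum_mono tail)
    also have "\<dots> \<le> G * ((E 0 + real t * C) / \<kappa>)"
      unfolding sum_distrib_left[symmetric] by (rule mult_left_mono) (fact, simp add: G_def)
    finally have "1 / real t * (\<Sum>\<tau><t. prob {\<omega> \<in> space M. D + m < Z \<tau> \<omega>})
        \<le> 1 / real t * (G * ((E 0 + real t * C) / \<kappa>))"
      by (rule mult_left_mono) simp
    also have "\<dots> = G * E 0 / \<kappa> * (1 / real t) + G * C / \<kappa>"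
      using that \<kappa>(1) by (simp add: field_simps)
    finally show ?thesis .
  qed
  have "(\<lambda>t. G * E 0 / \<kappa> * (1 / real t) + G * C / \<kappa>) \<longlonglongrightarrow> G * E 0 / \<kappa> * 0 + G * C / \<kappa>"
    by (intro tendsto_intros lim_1_over_n)
  then have "limsup (\<lambda>t. ereal (G * E 0 / \<kappa> * (1 / real t) + G * C / \<kappa>)) = ereal (G * C / \<kappa>)"
    by (intro lim_imp_Limsup) (simp_all)
  moreover have "limsup (\<lambda>t. ereal (1 / real t * (\<Sum>\<tau><t. prob {\<omega> \<in> space M. D + m < Z \<tau> \<omega>})))
      \<le> limsup (\<lambda>t. ereal (G * E 0 / \<kappa> * (1 / real t) + G * C / \<kappa>))"
    by (intro Limsup_mono eventually_sequentiallyI[of 1]) (simp only: ereal_less_eq, rule avg, simp)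
  moreover have "G * C / \<kappa> = 2 * exp (w * K) / (w * \<eta>) * exp (- w * m)"
  proof -
    have "G * C = exp (w * K) * exp (- w * m)"
      by (simp add: G_def C_def exp_add[symmetric] algebra_simps)
    then show ?thesis by (simp add: \<kappa>_def)
  qed
  ultimately show ?thesis by simp
qed

section \<open>Trajectories of the algorithm\<close>

locale qla_trajectory = bounded_network N \<delta> + prob_space M
  for N :: "('s::finite, 'x, 'r::finite) network" and \<delta> :: real and M :: "'w measure" +
  fixes V :: real and S :: "nat \<Rightarrow> 'w \<Rightarrow> 's" and X :: "nat \<Rightarrow> 'w \<Rightarrow> 'x"
    and U :: "nat \<Rightarrow> 'w \<Rightarrow> real ^ 'r"
  assumes process: "qla_process N V M S X U"
begin

lemma backlog_measurable [measurable]: "U t \<in> borel_measurable M"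
  using process by (simp add: qla_process_def)

lemma backlog_start: "\<omega> \<in> space M \<Longrightarrow> U 0 \<omega> = 0"
  using process by (simp add: qla_process_def)

lemma backlog_step:
  "\<omega> \<in> space M \<Longrightarrow> U (Suc t) \<omega> $ j =
    max (U t \<omega> $ j - service N j (S t \<omega>) (X t \<omega>)) 0 + arrival N j (S t \<omega>) (X t \<omega>)"
  using process by (simp add: qla_process_def)

lemma action_choice: "\<omega> \<in> space M \<Longrightarrow> qla_choice N V (U t \<omega>) (S t \<omega>) (X t \<omega>)"
  using process by (simp add: qla_process_def)

lemma action_feasible: "\<omega> \<in> space M \<Longrightarrow> X t \<omega> \<in> feasible N (S t \<omega>)"
  using action_choice by (simp add: qla_choice_def)

lemma state_measurable [measurable]: "S t \<in> measurable M (count_space UNIV)"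
  using process by (simp add: qla_process_def indep_vars_def)

lemma prob_state: "prob {\<omega> \<in> space M. S t \<omega> = s} = pmf (state_pmf N) s"
proof -
  have "pmf (state_pmf N) s = measure (distr M (count_space UNIV) (S t)) {s}"
    using process by (simp add: qla_process_def pmf.rep_eq)
  also have "\<dots> = prob {\<omega> \<in> space M. S t \<omega> = s}"
    by (subst measure_distr) (auto intro!: arg_cong[where f = prob])
  finally show ?thesis by simp
qed

lemma backlog_nonneg: "\<omega> \<in> space M \<Longrightarrow> 0 \<le> U t \<omega> $ j"
proof (induction t)
  case (Suc t)
  then show ?case
    using arrival_nonneg[OF action_feasible[of \<omega> t], of j] by (simp add: backlog_step)
qed (simp add: backlog_start)

lemma backlog_increment: "\<omega> \<in> space M \<Longrightarrow> norm (U (Suc t) \<omega> - U t \<omega>) \<le> max_step"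
  by (rule queue_step_norm_le[OF action_feasible]) (auto simp: backlog_step backlog_nonneg)

lemma distance_increment:
  assumes "\<omega> \<in> space M"
  shows "\<bar>norm (U (Suc t) \<omega> - w) - norm (U t \<omega> - w)\<bar> \<le> max_step"
  using norm_triangle_ineq3[of "U (Suc t) \<omega> - w" "U t \<omega> - w"] backlog_increment[OF assms, of t]
  by simp

lemma distance_bound:
  assumes "\<omega> \<in> space M"
  shows "norm (U t \<omega> - w) \<le> norm w + real t * max_step"
proof (induction t)
  case (Suc t)
  then show ?case using distance_increment[OF assms, of t w] by (simp add: algebra_simps)
qed (simp add: backlog_start assms)

lemma subalgebra_backlog: "subalgebra M (backlog_algebra M (U t))"
  using measurable_sets[OF backlog_measurable] by (auto simp: subalgebra_def sets_vimage_algebra2)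

lemma integrable_distance: "integrable M (\<lambda>\<omega>. norm (U t \<omega> - w))"
  by (rule integrable_const_bound[of _ "norm w + real t * max_step"]) (auto simp: distance_bound)

text \<open>The pointwise bound \<open>qla_step_drift\<close> is a function \<open>\<phi>\<close> of the state and the backlog
  alone. Its conditional expectation is the \<open>p\<close>-average over the states, in which the state duals
  add up to \<open>dual_fun\<close>, and the assumption on the dual gap applies.\<close>

lemma conditional_drift:
  assumes w: "\<And>j. 0 \<le> w $ j" and D: "0 < D"
    and gap: "\<And>u. (\<And>j. 0 \<le> u $ j) \<Longrightarrow> D \<le> norm (u - w) \<Longrightarrow>
      max_step\<^sup>2 + \<eta> * norm (u - w) \<le> dual_fun N V w - dual_fun N V u"
  shows "AE \<omega> in M. D \<le> norm (U t \<omega> - w) \<longrightarrow>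
    real_cond_exp M (backlog_algebra M (U t)) (\<lambda>\<omega>. norm (U (Suc t) \<omega> - w)) \<omega>
      \<le> norm (U t \<omega> - w) - \<eta>"
proof -
  interpret finite_measure_subalgebra M "backlog_algebra M (U t)"
    by standard (rule subalgebra_backlog)
  \<comment> \<open>Below the threshold the quotient may be unbounded, so there the crude bound on the increment
    takes its place; this keeps \<open>\<phi>\<close> integrable.\<close>
  define \<psi> where "\<psi> s u = (if D \<le> norm (u - w)
    then (max_step\<^sup>2 + state_dual N V s u - state_dual N V s w) / norm (u - w) else max_step)" for s u
  define \<phi> where "\<phi> s u = norm (u - w) + \<psi> s u" for s u
  have \<phi>_measurable [measurable]: "\<phi> s \<in> borel_measurable borel" for s
    unfolding \<phi>_def \<psi>_def by measurable
  have \<psi>_bound: "\<bar>\<psi> s u\<bar> \<le> max_step\<^sup>2 / D + max_step" for s u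
  proof (cases "D \<le> norm (u - w)")
    case True
    have "\<bar>\<psi> s u\<bar> = \<bar>max_step\<^sup>2 + (state_dual N V s u - state_dual N V s w)\<bar> / norm (u - w)"
      using True by (simp add: \<psi>_def add_diff_eq)
    also have "\<dots> \<le> (max_step\<^sup>2 + max_step * norm (u - w)) / norm (u - w)"
      using abs_triangle_ineq[of "max_step\<^sup>2" "state_dual N V s u - state_dual N V s w"]
        state_dual_lipschitz[of V s u w] by (intro divide_right_mono) auto
    also have "\<dots> = max_step\<^sup>2 / norm (u - w) + max_step"
      using less_le_trans[OF D True] by (simp add: add_divide_distrib)
    also have "\<dots> \<le> max_step\<^sup>2 / D + max_step"
      using less_le_trans[OF D True] True D by (simp add: divide_left_mono)
    finally show ?thesis .
  qed (use max_step_pos D in \<open>simp add: \<psi>_def\<close>)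
  have int_\<phi>: "integrable M (\<lambda>\<omega>. \<phi> s (U t \<omega>))" for s
  proof (rule integrable_const_bound)
    show "AE \<omega> in M. norm (\<phi> s (U t \<omega>))
        \<le> (norm w + real t * max_step) + (max_step\<^sup>2 / D + max_step)"
    proof (rule AE_I2)
      fix \<omega> assume "\<omega> \<in> space M"
      then show "norm (\<phi> s (U t \<omega>)) \<le> (norm w + real t * max_step) + (max_step\<^sup>2 / D + max_step)"
        unfolding \<phi>_def real_norm_def
        by (intro order_trans[OF abs_triangle_ineq] add_mono \<psi>_bound) (simp add: distance_bound)
    qed
  qed measurable
  have int_\<phi>S: "integrable M (\<lambda>\<omega>. \<phi> (S t \<omega>) (U t \<omega>))"
  proof (rule Bochner_Integration.integrable_bound)
    show "integrable M (\<lambda>\<omega>. \<Sum>s\<in>UNIV. \<bar>\<phi> s (U t \<omega>)\<bar>)" using int_\<phi> by auto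
    show "AE \<omega> in M. norm (\<phi> (S t \<omega>) (U t \<omega>)) \<le> norm (\<Sum>s\<in>UNIV. \<bar>\<phi> s (U t \<omega>)\<bar>)"
      using member_le_sum[of _ UNIV "\<lambda>s. \<bar>\<phi> s (U t _)\<bar>"] by (auto simp: sum_nonneg)
  qed measurable
  have le_\<phi>: "norm (U (Suc t) \<omega> - w) \<le> \<phi> (S t \<omega>) (U t \<omega>)" if \<omega>: "\<omega> \<in> space M" for \<omega>
  proof (cases "D \<le> norm (U t \<omega> - w)")
    case True
    then show ?thesis
      using qla_step_drift[OF action_choice[OF \<omega>] backlog_nonneg[OF \<omega>] w backlog_step[OF \<omega>]
          less_le_trans[OF D True]] True
      by (simp add: \<phi>_def \<psi>_def)
  next
    case False
    then show ?thesis
      using distance_increment[OF \<omega>, of t w] by (simp add: \<phi>_def \<psi>_def)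
  qed
  have indep: "indep_set (sets (backlog_algebra M (U t)))
      (sets (vimage_algebra (space M) (S t) (count_space UNIV)))"
    using process by (simp add: qla_process_def)
  have mean_\<phi>: "(\<Sum>s\<in>UNIV. pmf (state_pmf N) s * \<phi> s u) \<le> norm (u - w) - \<eta>"
    if u: "\<And>j. 0 \<le> u $ j" "D \<le> norm (u - w)" for u
  proof -
    let ?a = "norm (u - w)"
    have a: "0 < ?a" using u(2) D by linarith
    have "(\<Sum>s\<in>UNIV. pmf (state_pmf N) s * \<phi> s u)
        = (\<Sum>s\<in>UNIV. pmf (state_pmf N) s * (?a + max_step\<^sup>2 / ?a)
          + (pmf (state_pmf N) s * state_dual N V s u - pmf (state_pmf N) s * state_dual N V s w) / ?a)"
      using u(2) by (intro sum.cong refl)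
        (simp add: \<phi>_def \<psi>_def add_divide_distrib diff_divide_distrib algebra_simps)
    also have "\<dots> = (?a + max_step\<^sup>2 / ?a) + (dual_fun N V u - dual_fun N V w) / ?a"
      by (simp add: sum.distrib sum_subtractf sum_distrib_right[symmetric]
          sum_divide_distrib[symmetric] sum_pmf_eq_1 dual_fun_eq_sum)
    also have "\<dots> = ?a + (max_step\<^sup>2 + dual_fun N V u - dual_fun N V w) / ?a"
      by (simp add: add_divide_distrib diff_divide_distrib)
    also have "\<dots> \<le> ?a + (- \<eta>)"
      using gap[OF u] a by (intro add_left_mono) (simp add: pos_divide_le_eq)
    finally show ?thesis by simp
  qed
  have "AE \<omega> in M. real_cond_exp M (backlog_algebra M (U t)) (\<lambda>\<omega>. \<phi> (S t \<omega>) (U t \<omega>)) \<omega>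
      = (\<Sum>s\<in>UNIV. pmf (state_pmf N) s * \<phi> s (U t \<omega>))"
    using real_cond_exp_indep_finite[OF backlog_measurable state_measurable indep \<phi>_measurable int_\<phi>]
    unfolding prob_state .
  moreover have "AE \<omega> in M. real_cond_exp M (backlog_algebra M (U t)) (\<lambda>\<omega>. norm (U (Suc t) \<omega> - w)) \<omega>
      \<le> real_cond_exp M (backlog_algebra M (U t)) (\<lambda>\<omega>. \<phi> (S t \<omega>) (U t \<omega>)) \<omega>"
    by (rule real_cond_exp_mono[OF AE_I2[OF le_\<phi>] integrable_distance int_\<phi>S])
  ultimately show ?thesis
    using AE_space
  proof eventually_elim
    case (elim \<omega>)
    then show ?case using mean_\<phi>[OF backlog_nonneg, of \<omega> t] by auto
  qed
qed

lemma deviation_freq_le: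
  assumes drift: "\<And>t. AE \<omega> in M. D \<le> norm (U t \<omega> - w) \<longrightarrow>
      real_cond_exp M (backlog_algebra M (U t)) (\<lambda>\<omega>. norm (U (Suc t) \<omega> - w)) \<omega>
        \<le> norm (U t \<omega> - w) - \<eta>"
    and \<beta>: "0 < \<beta>" "\<beta> * max_step \<le> 1" "2 * \<beta> * max_step\<^sup>2 \<le> \<eta>" "\<beta> * \<eta> \<le> 2" and \<eta>: "0 < \<eta>"
  shows "deviation_freq M U w D m \<le> ereal (2 * exp 1 / (\<beta> * \<eta>) * exp (- \<beta> * m))"
proof -
  have adapted: "(\<lambda>\<omega>. norm (U t \<omega> - w)) \<in> borel_measurable (backlog_algebra M (U t))" for t
    by (rule measurable_compose[OF measurable_vimage_algebra1]) auto
  have "deviation_freq M U w D m \<le> ereal (2 * exp (\<beta> * max_step) / (\<beta> * \<eta>) * exp (- \<beta> * m))"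
    unfolding deviation_freq_def
    by (rule exponential_tail_of_drift[where F = "\<lambda>t. backlog_algebra M (U t)"
          and Z = "\<lambda>t \<omega>. norm (U t \<omega> - w)" and ?z0.0 = "norm w",
          OF subalgebra_backlog adapted _ _ drift \<beta> \<eta>])
      (auto simp: backlog_start distance_increment)
  also have "\<dots> \<le> ereal (2 * exp 1 / (\<beta> * \<eta>) * exp (- \<beta> * m))"
    using \<beta> \<eta> by (auto intro!: mult_right_mono divide_right_mono)
  finally show ?thesis .
qed

end

text \<open>The feasible sets are nonempty because they contain the actions of the slackness condition.\<close>

lemma queueing_network_imp_bounded:
  assumes "queueing_network N"
  obtains \<delta> where "bounded_network N \<delta>"
proof -
  obtain \<delta> where \<delta>: "0 < \<delta>" "\<And>s x. x \<in> feasible N s \<Longrightarrow> \<bar>cost N s x\<bar> \<le> \<delta> \<and>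
        (\<forall>j. \<bar>arrival N j s x\<bar> \<le> \<delta> \<and> \<bar>service N j s x\<bar> \<le> \<delta>)"
    using assms unfolding queueing_network_def by metis
  have nonneg: "\<And>j s x. x \<in> feasible N s \<Longrightarrow> 0 \<le> arrival N j s x \<and> 0 \<le> service N j s x"
    using assms unfolding queueing_network_def by metis
  have "slackness N" using assms by (simp add: queueing_network_def)
  then obtain xs :: "'a \<Rightarrow> nat \<Rightarrow> 'b" where "\<forall>s. \<forall>k\<in>{1..CARD('c) + 2}. xs s k \<in> feasible N s"
    unfolding slackness_def by metis
  then have "xs s 1 \<in> feasible N s" for s by simp
  then have "feasible N s \<noteq> {}" for s by blast
  with \<delta> nonneg have "bounded_network N \<delta>"
    by unfold_locales (auto dest: abs_le_D1)
  then show ?thesis by (rule that)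
qed

section \<open>The choice of the constants\<close>

theorem theorem4:
  fixes N :: "('s::finite, 'x::topological_space, 'r::finite) network"
    and \<epsilon> L :: real
  assumes "queueing_network N"
    and "\<forall>V\<ge>1. \<exists>!u. is_dual_opt N V u"
    and "0 < \<epsilon>" and "0 < L"
    and "locally_smooth (dual_fun N 1) (dual_opt N 1) \<epsilon> L"
  shows "\<exists>D c \<beta> :: real \<Rightarrow> real.
    D \<in> \<Theta>(\<lambda>V. sqrt V) \<and> c \<in> \<Theta>(\<lambda>V. V) \<and> \<beta> \<in> \<Theta>(\<lambda>V. 1 / sqrt V) \<and>
    (\<forall>\<^sub>F V in at_top. 0 < D V \<and> 0 < c V \<and> 0 < \<beta> V \<and>
      (\<forall>(M :: 'w measure) S X U. qla_process N V M S X U \<longrightarrow>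
        (\<forall>t. AE \<omega> in M. norm (U t \<omega> - dual_opt N V) \<ge> D V \<longrightarrow>
           real_cond_exp M (backlog_algebra M (U t)) (\<lambda>\<omega>'. norm (U (Suc t) \<omega>' - dual_opt N V)) \<omega>
             \<le> norm (U t \<omega> - dual_opt N V) - 1 / sqrt V) \<and>
        (\<forall>m\<ge>0. deviation_freq M U (dual_opt N V) (D V) m \<le> ereal (c V * exp (- \<beta> V * m)))))"
proof -
  obtain \<delta> where "bounded_network N \<delta>"
    using queueing_network_imp_bounded[OF assms(1)] .
  then interpret bounded_network N \<delta> .
  let ?K = "max_step"
  have K: "0 < ?K" by (rule max_step_pos)
  \<comment> \<open>Drift \<open>1 / sqrt V\<close> at distance \<open>a \<ge> D V\<close> needs a gap of at least \<open>?K\<^sup>2 + a / sqrt V\<close>. As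
    \<open>a \<ge> sqrt V\<close>, a gap of \<open>(1 + ?K\<^sup>2) a / sqrt V\<close> suffices, which the quadratic regime
    \<open>L a\<^sup>2 / V\<close> supplies if \<open>L d \<ge> 1 + ?K\<^sup>2\<close>; the summand 1 ensures \<open>d \<ge> 1\<close>.\<close>
  define d where "d = (1 + ?K\<^sup>2) / L + 1"
  have d: "1 \<le> d" "1 + ?K\<^sup>2 \<le> L * d"
    using assms(4) by (auto simp: d_def field_simps)
  define D where "D V = d * sqrt V" for V
  \<comment> \<open>\<open>\<beta>\<close> is the largest rate with \<open>2 \<beta> ?K\<^sup>2 \<le> 1 / sqrt V\<close>, and \<open>c\<close> is the
    resulting prefactor \<open>2 exp 1 / (\<beta> / sqrt V)\<close>.\<close>
  define c where "c V = 4 * ?K\<^sup>2 * exp 1 * V" for V :: real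
  define \<beta> where "\<beta> V = 1 / (2 * ?K\<^sup>2) * (1 / sqrt V)" for V
  \<comment> \<open>A lower bound on \<open>sqrt V\<close>. The second summand keeps \<open>\<beta>\<close> small enough for the
    exponential Lyapunov function, the third one ensures that the
    linear regime \<open>L a \<epsilon> / 2\<close> of the gap is large enough as well.\<close>
  define r0 where "r0 = 1 + 1 / ?K + 2 * (1 + ?K\<^sup>2) / (L * \<epsilon>)"
  have r0: "1 \<le> r0" "1 / ?K \<le> r0" "2 * (1 + ?K\<^sup>2) / (L * \<epsilon>) \<le> r0"
    using K assms(3,4) by (auto simp: r0_def add_increasing2)
  have u0: "is_dual_opt N 1 (dual_opt N 1)"
    using theI'[of "is_dual_opt N 1"] assms(2) by (auto simp: dual_opt_def)
  then have u0_nonneg: "0 \<le> dual_opt N 1 $ j" for j by (simp add: is_dual_opt_def)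
  have large: "0 < D V \<and> 0 < c V \<and> 0 < \<beta> V \<and>
      (\<forall>(M :: 'w measure) S X U. qla_process N V M S X U \<longrightarrow>
        (\<forall>t. AE \<omega> in M. norm (U t \<omega> - dual_opt N V) \<ge> D V \<longrightarrow>
           real_cond_exp M (backlog_algebra M (U t)) (\<lambda>\<omega>'. norm (U (Suc t) \<omega>' - dual_opt N V)) \<omega>
             \<le> norm (U t \<omega> - dual_opt N V) - 1 / sqrt V) \<and>
        (\<forall>m\<ge>0. deviation_freq M U (dual_opt N V) (D V) m \<le> ereal (c V * exp (- \<beta> V * m))))"
    if V: "r0\<^sup>2 \<le> V" for V
  proof -
    define r where "r = sqrt V"
    have r: "r0 \<le> r" using V r0 by (simp add: r_def real_le_rsqrt)
    have r1: "1 \<le> r" using r r0 by linarith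
    have Vr: "V = r\<^sup>2" using order_trans[OF zero_le_power2 V] by (simp add: r_def)
    have V1: "1 \<le> V" using r1 by (simp add: Vr)
    have opt: "dual_opt N V = V *\<^sub>R dual_opt N 1"
      using assms(2) V1 by (intro dual_opt_scale) auto
    have opt_nonneg: "0 \<le> dual_opt N V $ j" for j
      using u0_nonneg V1 by (simp add: opt)
    have Kr: "1 \<le> r * ?K" using order_trans[OF r0(2) r] K by (simp add: divide_le_eq)
    have Kr2: "1 \<le> r\<^sup>2 * ?K\<^sup>2" using power_mono[OF Kr, of 2] by (simp add: power_mult_distrib)
    have \<epsilon>r: "(1 + ?K\<^sup>2) / r \<le> L * (\<epsilon> / 2)"
      using order_trans[OF r0(3) r] r1 assms(3,4) by (simp add: field_simps)
    have gap: "?K\<^sup>2 + 1 / r * norm (u - dual_opt N V)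
        \<le> dual_fun N V (dual_opt N V) - dual_fun N V u"
      if u: "\<And>j. 0 \<le> u $ j" "D V \<le> norm (u - dual_opt N V)" for u
    proof -
      let ?a = "norm (u - dual_opt N V)"
      have ad: "d * r \<le> ?a" using u(2) by (simp add: D_def r_def)
      have ar: "r \<le> ?a" using order_trans[OF mult_right_mono[OF d(1), of r] ad] r1 by simp
      have "(1 + ?K\<^sup>2) / r \<le> L * d / r"
        using d r1 by (intro divide_right_mono) auto
      also have "\<dots> = L * (d * r) / V" using r1 by (simp add: Vr power2_eq_square)
      also have "\<dots> \<le> L * (?a / V)"
        using ad V1 assms(4) by (simp add: divide_right_mono)
      finally have "(1 + ?K\<^sup>2) / r \<le> L * min (?a / V) (\<epsilon> / 2)"
        using \<epsilon>r by (simp add: min_def)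
      then have "(1 + ?K\<^sup>2) / r * ?a \<le> L * min (?a / V) (\<epsilon> / 2) * ?a"
        by (intro mult_right_mono) auto
      also have "\<dots> \<le> dual_fun N V (dual_opt N V) - dual_fun N V u"
        unfolding opt using scaled_dual_gap[OF assms(5,3,4) _ u0_nonneg u(1)] V1 by simp
      finally have "(1 + ?K\<^sup>2) / r * ?a \<le> dual_fun N V (dual_opt N V) - dual_fun N V u" .
      moreover have "?K\<^sup>2 * 1 \<le> ?K\<^sup>2 * (?a / r)"
        using ar r1 by (intro mult_left_mono) auto
      ultimately show ?thesis by (simp add: add_divide_distrib distrib_right)
    qed
    have D_pos: "0 < D V" using d r1 by (simp add: D_def r_def[symmetric])
    have \<beta>: "0 < \<beta> V" "\<beta> V * ?K \<le> 1" "2 * \<beta> V * ?K\<^sup>2 \<le> 1 / r" "\<beta> V * (1 / r) \<le> 2"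
    proof -
      show "0 < \<beta> V" using K r1 by (simp add: \<beta>_def r_def[symmetric])
      have "\<beta> V * ?K = 1 / (2 * (r * ?K))"
        using K by (simp add: \<beta>_def r_def[symmetric] power2_eq_square)
      also have "\<dots> \<le> 1" using Kr by simp
      finally show "\<beta> V * ?K \<le> 1" .
      show "2 * \<beta> V * ?K\<^sup>2 \<le> 1 / r" using K by (simp add: \<beta>_def r_def[symmetric])
      have "\<beta> V * (1 / r) = 1 / (2 * (r\<^sup>2 * ?K\<^sup>2))"
        by (simp add: \<beta>_def r_def[symmetric] power2_eq_square)
      also have "\<dots> \<le> 2" using Kr2 by (simp add: divide_le_eq)
      finally show "\<beta> V * (1 / r) \<le> 2" .
    qed
    have c_eq: "2 * exp 1 / (\<beta> V * (1 / r)) = c V"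
      using r1 K by (simp add: c_def \<beta>_def r_def[symmetric] Vr power2_eq_square)
    have "(\<forall>t. AE \<omega> in M. norm (U t \<omega> - dual_opt N V) \<ge> D V \<longrightarrow>
           real_cond_exp M (backlog_algebra M (U t)) (\<lambda>\<omega>'. norm (U (Suc t) \<omega>' - dual_opt N V)) \<omega>
             \<le> norm (U t \<omega> - dual_opt N V) - 1 / sqrt V) \<and>
        (\<forall>m\<ge>0. deviation_freq M U (dual_opt N V) (D V) m \<le> ereal (c V * exp (- \<beta> V * m)))"
      if process: "qla_process N V M S X U" for M :: "'w measure" and S X U
    proof -
      interpret prob_space M using process by (simp add: qla_process_def)
      interpret qla_trajectory N \<delta> M V S X U by unfold_locales (rule process)
      note drift = conditional_drift[OF opt_nonneg D_pos gap]
      have "1 / r > 0" using r1 by simp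
      from deviation_freq_le[OF drift \<beta> this] drift show ?thesis
        unfolding c_eq r_def[symmetric] by blast
    qed
    moreover have "0 < c V" using K V1 by (simp add: c_def)
    ultimately show ?thesis using D_pos \<beta>(1) by blast
  qed
  have "D \<in> \<Theta>(\<lambda>V. sqrt V)" using d by (simp add: D_def[abs_def])
  moreover have "c \<in> \<Theta>(\<lambda>V. V)" using K by (simp add: c_def[abs_def])
  moreover have "\<beta> \<in> \<Theta>(\<lambda>V. 1 / sqrt V)"
    unfolding \<beta>_def[abs_def] using K by (subst landau_theta.cmult_in_iff) auto
  moreover note eventually_mono[OF eventually_ge_at_top large]
  ultimately show ?thesis by (intro exI[of _ D] exI[of _ c] exI[of _ \<beta>] conjI)
qed

end
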